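(* Let $n\ge 1$, $d\ge 1$, let $\sigma>0$ be a constant, and let $p_1,\dots,p_n:[0,\infty)\to\mathbb{R}^d$ be the trajectories of $n$ agents moving according to $$\dot p_i(t)=-\sigma\sum_{j=1}^{n}\bigl(p_i(t)-p_j(t)\bigr),\qquad i=1,\dots,n .$$ Then, for arbitrary initial positions $p_1(0),\dots,p_n(0)\in\mathbb{R}^d$, all agents asymptotically converge to the average location of the initial constellation, i.e. for every $i$, $$\lim_{t\to\infty}p_i(t)=\frac1n\sum_{j=1}^n p_j(0).$$
   Context: This is the continuous-time system $\mathcal{S}_1$ (unlimited visibility, relative position sensing): every agent senses the relative positions of all other agents. *)

theory Defs
  imports "HOL-Analysis.Analysis"
begin

end

theory Submission
  imports Defs
begin

text \<open>The centroid \<open>m\<close> is conserved, so each agent obeys the decoupled linear equation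
  \<open>p' = - \<sigma> n (p - m)\<close>; multiplying by the integrating factor shows that its distance
  to \<open>m\<close> decays exponentially.\<close>

text \<open>The derivative of \<open>exp (k * t) *\<^sub>R (x t - m)\<close> vanishes, so this
  product keeps its value at \<open>0\<close>. Solving for \<open>x t\<close> gives the closed form,
  with no appeal to a uniqueness theorem for differential equations.\<close>

lemma linear_ode_solution:
  fixes x :: "real \<Rightarrow> 'a :: real_normed_vector"
  assumes deriv: "\<And>t. t \<ge> 0 \<Longrightarrow> (x has_vector_derivative (- k *\<^sub>R (x t - m))) (at t within {0..})"
    and "t \<ge> 0"
  shows "x t = m + exp (- k * t) *\<^sub>R (x 0 - m)"
proof -
  define g where "g = (\<lambda>t. exp (k * t) *\<^sub>R (x t - m))"
  have "(g has_vector_derivative 0) (at s within {0..})" if "s \<in> {0..}" for s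
  proof -
    have "((\<lambda>t. exp (k * t)) has_real_derivative k * exp (k * s)) (at s within {0..})"
      by (auto intro!: derivative_eq_intros)
    moreover have "((\<lambda>t. x t - m) has_vector_derivative (- k *\<^sub>R (x s - m))) (at s within {0..})"
      using deriv that by (simp only: has_vector_derivative_diff_const atLeast_iff)
    \<comment> \<open>The product rule gives two terms that are negatives of each other.\<close>
    ultimately have "(g has_vector_derivative
        (exp (k * s) *\<^sub>R (- k *\<^sub>R (x s - m)) + (k * exp (k * s)) *\<^sub>R (x s - m))) (at s within {0..})"
      unfolding g_def by (rule has_vector_derivative_scaleR)
    then show ?thesis by (simp add: mult.commute)
  qed
  \<comment> \<open>A zero derivative within \<open>{0..}\<close> forces constancy because this
    half-line is convex; at \<open>0\<close> the derivative is one-sided.\<close>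
  then obtain c where "\<And>s. s \<in> {0..} \<Longrightarrow> g s = c"
    using has_vector_derivative_zero_constant[of "{0..}" g] by auto
  then have "g t = g 0" using \<open>t \<ge> 0\<close> by simp
  then have "exp (- k * t) *\<^sub>R g t = exp (- k * t) *\<^sub>R (x 0 - m)" by (simp add: g_def)
  then show ?thesis
    by (simp add: g_def algebra_simps flip: exp_add)
qed

lemma linear_ode_tendsto:
  fixes x :: "real \<Rightarrow> 'a :: real_normed_vector"
  assumes "\<And>t. t \<ge> 0 \<Longrightarrow> (x has_vector_derivative (- k *\<^sub>R (x t - m))) (at t within {0..})"
    and "k > 0"
  shows "(x \<longlongrightarrow> m) at_top"
proof -
  have "filterlim (\<lambda>t. - k * t) at_bot at_top"
    using \<open>k > 0\<close> by (intro filterlim_tendsto_neg_mult_at_bot[OF tendsto_const] filterlim_ident) auto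
  then have "((\<lambda>t. exp (- k * t)) \<longlongrightarrow> 0) at_top"
    by (rule filterlim_compose[OF exp_at_bot])
  then have "((\<lambda>t. m + exp (- k * t) *\<^sub>R (x 0 - m)) \<longlongrightarrow> m + 0 *\<^sub>R (x 0 - m)) at_top"
    by (intro tendsto_intros)
  \<comment> \<open>The closed form is known only for \<open>t \<ge> 0\<close>, so the limit is
    transferred through eventual equality.\<close>
  moreover have "\<forall>\<^sub>F t in at_top. m + exp (- k * t) *\<^sub>R (x 0 - m) = x t"
    using eventually_ge_at_top[of 0]
    by eventually_elim (rule linear_ode_solution[OF assms(1), symmetric])
  ultimately show ?thesis by (simp add: tendsto_cong)
qed

theorem theorem1:
  fixes n :: nat and \<sigma> :: real and p :: "nat \<Rightarrow> real \<Rightarrow> real ^ 'd"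
  assumes "n \<ge> 1"
    and "\<sigma> > 0"
    and "\<And>i t. i \<in> {1..n} \<Longrightarrow> t \<ge> 0 \<Longrightarrow>
           (p i has_vector_derivative (- \<sigma> *\<^sub>R (\<Sum>j=1..n. p i t - p j t))) (at t within {0..})"
  shows "\<forall>i\<in>{1..n}. (p i \<longlongrightarrow> (1 / real n) *\<^sub>R (\<Sum>j=1..n. p j 0)) at_top"
proof
  fix i assume i: "i \<in> {1..n}"
  define S where "S = (\<lambda>t. \<Sum>j=1..n. p j t)"
  define m where "m = (1 / real n) *\<^sub>R S 0"
  have "(S has_vector_derivative 0) (at t within {0..})" if "t \<in> {0..}" for t
  proof -
    have "(S has_vector_derivative (\<Sum>i=1..n. - \<sigma> *\<^sub>R (\<Sum>j=1..n. p i t - p j t))) (at t within {0..})"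
      unfolding S_def using assms(3) that by (intro has_vector_derivative_sum) auto
    moreover have "(\<Sum>i=1..n. - \<sigma> *\<^sub>R (\<Sum>j=1..n. p i t - p j t)) = - \<sigma> *\<^sub>R (\<Sum>i=1..n. \<Sum>j=1..n. p i t - p j t)"
      by (rule scaleR_sum_right[symmetric])
    \<comment> \<open>The summand is antisymmetric in \<open>i\<close> and \<open>j\<close>: the
      pairwise attractions cancel, which is why the centroid stays fixed.\<close>
    moreover have "(\<Sum>i=1..n. \<Sum>j=1..n. p i t - p j t) = 0"
      by (simp add: sum_subtractf sum_distrib_left)
    ultimately show ?thesis by simp
  qed
  then obtain c where "\<And>t. t \<in> {0..} \<Longrightarrow> S t = c"
    using has_vector_derivative_zero_constant[of "{0..}" S] by auto
  \<comment> \<open>The constant \<open>c\<close> is \<open>S 0\<close>, and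
    \<open>n \<ge> 1\<close> allows cancelling the factor \<open>1 / real n\<close> in
    \<open>m\<close>.\<close>
  then have "S t = real n *\<^sub>R m" if "t \<ge> 0" for t
    using \<open>n \<ge> 1\<close> that by (simp add: m_def)
  \<comment> \<open>This is the decoupling: the other agents enter only through \<open>S t\<close>,
    which is now known, so agent \<open>i\<close> is driven towards \<open>m\<close> at rate
    \<open>\<sigma> * real n\<close>.\<close>
  then have "(\<Sum>j=1..n. p i t - p j t) = real n *\<^sub>R (p i t - m)" if "t \<ge> 0" for t
    using that by (simp add: S_def sum_subtractf sum_constant_scaleR scaleR_diff_right del: sum_constant)
  then have "(p i has_vector_derivative (- (\<sigma> * real n) *\<^sub>R (p i t - m))) (at t within {0..})" if "t \<ge> 0" for t
    using assms(3)[OF i that] that by simp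
  then have "(p i \<longlongrightarrow> m) at_top"
    using assms(1,2) by (intro linear_ode_tendsto[where k = "\<sigma> * real n"]) auto
  then show "(p i \<longlongrightarrow> (1 / real n) *\<^sub>R (\<Sum>j=1..n. p j 0)) at_top"
    by (simp add: m_def S_def)
qed

end
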